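(* For every even integer $\Delta$ with $\Delta\ge 4$, and every positive integer $g$, there exists a bipartite planar graph $G_{\Delta,g}$ with maximum degree $\Delta$ and girth at least $g$ such that $\chi_{\mathrm{os}}(G_{\Delta,g})=4$.
   Context: Graphs are finite, simple and undirected. For a vertex $v$ of a graph $G$, $N(v)=\{x: vx\in E(G)\}$ and $N[v]=N(v)\cup\{v\}$. A coloring of $G$ is a map $f:V(G)\to\mathbb{Z}^+$ (positive integers) such that $f(v)\ne f(w)$ for all $vw\in E(G)$. A coloring $f$ is an odd-sum coloring if $\sum_{w\in N[v]}f(w)$ is odd for each vertex $v\in V(G)$. The odd-sum chromatic number $\chi_{\mathrm{os}}(G)$ is the minimum size of the range of an odd-sum coloring of $G$ (it is known that every finite graph has an odd-sum coloring). The girth of a graph is the length of its shortest cycle. *)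

theory Defs
  imports "HOL-Analysis.Analysis" "Graph_Theory.Pair_Digraph" "HOL-Library.Extended_Nat"
begin

text \<open>
  A finite simple undirected graph is a \<^locale>\<open>pair_graph\<close>: a finite vertex set with a finite,
  symmetric and irreflexive adjacency relation on it. An undirected edge is thus represented
  by its two orientations.
\<close>

definition neighborhood :: "'a pair_pre_digraph \<Rightarrow> 'a \<Rightarrow> 'a set" where
  "neighborhood G v = {x. (v, x) \<in> parcs G}"

definition closed_neighborhood :: "'a pair_pre_digraph \<Rightarrow> 'a \<Rightarrow> 'a set" where
  "closed_neighborhood G v = neighborhood G v \<union> {v}"

definition max_degree :: "'a pair_pre_digraph \<Rightarrow> nat" where
  "max_degree G = Max ((\<lambda>v. card (neighborhood G v)) ` pverts G)"

text \<open>
  In a symmetric digraph the closed walk \<open>u, v, u\<close> along an edge and its reverse satisfies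
  \<^const>\<open>pre_digraph.cycle\<close>; the bound on the length excludes exactly these. The girth of an
  acyclic graph is the infimum of the empty set, that is \<open>\<infinity>\<close>.
\<close>

definition girth :: "'a pair_pre_digraph \<Rightarrow> enat" where
  "girth G = (INF p \<in> {p. pre_digraph.cycle (with_proj G) p \<and> 3 \<le> length p}. enat (length p))"

definition bipartite :: "'a pair_pre_digraph \<Rightarrow> bool" where
  "bipartite G \<longleftrightarrow>
     (\<exists>A B. pverts G = A \<union> B \<and> A \<inter> B = {} \<and> parcs G \<subseteq> A \<times> B \<union> B \<times> A)"

text \<open>
  A drawing without crossings: vertices go to distinct points (\<open>pos\<close>), edges to simple arcs
  (\<open>crv\<close>) joining their ends. An arc meets no other vertex, and arcs of different undirected
  edges meet only in common ends. The two orientations of an edge share one curve.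
\<close>

definition plane_drawing ::
  "'a pair_pre_digraph \<Rightarrow> ('a \<Rightarrow> complex) \<Rightarrow> ('a \<times> 'a \<Rightarrow> real \<Rightarrow> complex) \<Rightarrow> bool" where
  "plane_drawing G pos crv \<longleftrightarrow>
     inj_on pos (pverts G) \<and>
     (\<forall>(u, v) \<in> parcs G.
        arc (crv (u, v)) \<and> pathstart (crv (u, v)) = pos u \<and> pathfinish (crv (u, v)) = pos v \<and>
        crv (v, u) = reversepath (crv (u, v))) \<and>
     (\<forall>(u, v) \<in> parcs G. \<forall>w \<in> pverts G.
        pos w \<in> path_image (crv (u, v)) \<longrightarrow> w \<in> {u, v}) \<and>
     (\<forall>(u, v) \<in> parcs G. \<forall>(x, y) \<in> parcs G. {u, v} \<noteq> {x, y} \<longrightarrow>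
        path_image (crv (u, v)) \<inter> path_image (crv (x, y)) \<subseteq> pos ` ({u, v} \<inter> {x, y}))"

definition planar :: "'a pair_pre_digraph \<Rightarrow> bool" where
  "planar G \<longleftrightarrow> (\<exists>pos crv. plane_drawing G pos crv)"

text \<open>Only the values of a coloring on the vertex set are relevant.\<close>

definition coloring :: "'a pair_pre_digraph \<Rightarrow> ('a \<Rightarrow> nat) \<Rightarrow> bool" where
  "coloring G f \<longleftrightarrow> (\<forall>v \<in> pverts G. 0 < f v) \<and> (\<forall>(v, w) \<in> parcs G. f v \<noteq> f w)"

definition odd_sum_coloring :: "'a pair_pre_digraph \<Rightarrow> ('a \<Rightarrow> nat) \<Rightarrow> bool" where
  "odd_sum_coloring G f \<longleftrightarrow>
     coloring G f \<and> (\<forall>v \<in> pverts G. odd (\<Sum>w \<in> closed_neighborhood G v. f w))"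

text \<open>
  On a nonempty set of naturals \<^const>\<open>Inf\<close> is the minimum. On the empty set it is \<open>0\<close>, so a
  positive value entails that some odd-sum coloring exists.
\<close>

definition odd_sum_chromatic_number :: "'a pair_pre_digraph \<Rightarrow> nat" where
  "odd_sum_chromatic_number G = Inf {card (f ` pverts G) | f. odd_sum_coloring G f}"

end

theory Submission
  imports Defs
begin

text \<open>
  Modulo 2, an odd-sum coloring is a solution of a linear system over the field with two
  elements: the parities on each closed neighborhood sum to 1. In a bipartite graph two odd and
  two even colors suffice once a solution is fixed, so the value 4 arises exactly when every
  solution is constant 1 on some edge and constant 0 on some other edge. The first cannot
  happen in a forest, where the odd vertices would induce a subgraph with all degrees even and
  hence without edges; so a cycle is needed, and it may be taken as long as the girth demands.

  The graph is a cycle \<open>0, \<dots>, c\<close> with a path \<open>c, c + 1, c + 2\<close> attached, where the hub \<open>c + 2\<close>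
  also carries \<open>\<Delta> - 1\<close> leaves. A leaf and the hub have opposite parities; since \<open>\<Delta> - 1\<close> is
  odd, the equation at the hub then forces the tether \<open>c + 1\<close> to be even. So the tether does not
  disturb the equations on the cycle, where any three consecutive parities sum to 1 and the
  parities therefore have period 3. The length of the cycle is \<open>c + 1 \<equiv> 1\<close> modulo 3, which makes
  all parities equal, hence odd. The equation at \<open>c + 1\<close> finally makes the hub even. The edge
  \<open>{0, 1}\<close> thus uses two odd colors and the edge \<open>{c + 1, c + 2}\<close> two even ones
  (\<open>odd_sum_coloring_parities\<close>), while \<open>tethered_coloring\<close> uses only 1, 2, 3 and 4.

  The choice \<open>c = 6 g + 3\<close> makes the cycle long, even, and of length 1 modulo 3. The girth is
  bounded because the vertices of a cycle induce a subgraph of minimum degree at least 2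
  (\<open>cycle_vertices_two_neighbors\<close>), which rules out in turn the leaves, the hub and the tether.
  Planarity is shown by a straight-line drawing (\<open>segments_meet_in_common_ends\<close>).
\<close>

section \<open>Cycles and girth\<close>

lemma (in pair_pre_digraph) cas_nth_Suc:
  "cas u p v \<Longrightarrow> Suc i < length p \<Longrightarrow> snd (p ! i) = fst (p ! Suc i)"
proof (induction p arbitrary: u i)
  case Nil
  then show ?case by simp
next
  case (Cons e p)
  then show ?case
    by (cases i; cases p) auto
qed

lemma (in pair_pre_digraph) cas_ends_conv:
  "cas u p v \<Longrightarrow> p \<noteq> [] \<Longrightarrow> fst (p ! 0) = u \<and> snd (p ! (length p - 1)) = v"
proof (induction p arbitrary: u)
  case Nil
  then show ?case by simp
next
  case (Cons e p)
  then show ?case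
    by (cases p) auto
qed

text \<open>
  A vertex of a cycle has its predecessor and its successor on the cycle as neighbors, and these
  differ once the length is at least 3. This turns lower bounds on the girth into statements
  about vertex sets, without walks.
\<close>

lemma cycle_vertices_two_neighbors:
  assumes G: "pair_graph G"
    and cyc: "pre_digraph.cycle (with_proj G) p" and len: "3 \<le> length p"
  obtains C where "C \<noteq> {}" "C \<subseteq> pverts G" "card C = length p"
    "\<And>v. v \<in> C \<Longrightarrow> \<exists>a\<in>C. \<exists>b\<in>C. a \<noteq> b \<and> a \<in> neighborhood G v \<and> b \<in> neighborhood G v"
proof -
  interpret pair_graph G by fact
  let ?L = "length p"
  define b where "b i = snd (p ! i)" for i
  from cyc obtain u where u: "awalk u p u" "distinct (tl (awalk_verts u p))" "p \<noteq> []"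
    unfolding cycle_def by auto
  then have cas: "cas u p u" and sub: "set p \<subseteq> parcs G"
    by (auto simp: awalk_def)
  have "distinct (map snd p)"
    using u awalk_verts_conv'[OF cas] by simp
  then have inj: "inj_on b {..<?L}"
    by (auto simp: inj_on_def b_def distinct_conv_nth)
  have step: "(b i, b (Suc i mod ?L)) \<in> parcs G" if "i < ?L" for i
  proof -
    have "fst (p ! (Suc i mod ?L)) = b i"
    proof (cases "Suc i < ?L")
      case True
      then show ?thesis using cas_nth_Suc[OF cas] by (simp add: b_def)
    next
      case False
      then have "Suc i = ?L" using that by simp
      then have "i = ?L - 1" "Suc i mod ?L = 0" by simp_all
      then show ?thesis using cas_ends_conv[OF cas u(3)] by (simp add: b_def)
    qed
    moreover have "p ! (Suc i mod ?L) \<in> parcs G"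
      using sub that by (meson length_pos_if_in_set mod_less_divisor nth_mem subsetD u(3) length_greater_0_conv)
    ultimately show ?thesis by (metis b_def prod.collapse)
  qed
  show thesis
  proof (rule that[of "b ` {..<?L}"])
    show "b ` {..<?L} \<noteq> {}" using u(3) by (simp add: lessThan_empty_iff)
    show "b ` {..<?L} \<subseteq> pverts G"
      using step in_arcsD1 by auto
    show "card (b ` {..<?L}) = ?L"
      by (simp add: card_image inj)
    fix v assume "v \<in> b ` {..<?L}"
    then obtain i where i: "i < ?L" "v = b i" by auto
    define h where "h = (if i = 0 then ?L - 1 else i - 1)"
    define k where "k = Suc i mod ?L"
    have h: "h < ?L" "Suc h mod ?L = i" using i len by (auto simp: h_def)
    have k: "k < ?L" using len by (auto simp: k_def intro: mod_less_divisor)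
    \<comment> \<open>This is where a closed walk along one edge and back is excluded.\<close>
    have "h \<noteq> k"
      using i(1) len by (cases "Suc i = ?L") (auto simp: h_def k_def)
    then have "b h \<noteq> b k" using inj h k by (auto simp: inj_on_def)
    moreover have "b h \<in> neighborhood G v"
      using step[OF h(1)] h(2) i arcs_symmetric by (simp add: neighborhood_def)
    moreover have "b k \<in> neighborhood G v"
      using step[OF i(1)] i by (simp add: neighborhood_def k_def)
    ultimately show "\<exists>a\<in>b ` {..<?L}. \<exists>c\<in>b ` {..<?L}. a \<noteq> c \<and>
        a \<in> neighborhood G v \<and> c \<in> neighborhood G v"
      using h k by blast
  qed
qed

section \<open>Straight-line drawings\<close>

text \<open>
  For straight-line drawings it is enough to compare the segments of distinct edges, in one chosen
  orientation \<open>E\<close>. That a segment avoids every other vertex \<open>w\<close> follows: \<open>w\<close> is an end of some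
  edge, whose segment would meet the given one in a point that is no common end.
\<close>

lemma straight_line_planar:
  fixes pos :: "'a \<Rightarrow> complex"
  assumes arcs: "parcs G = E \<union> E\<inverse>"
    and loopfree: "\<And>u. (u, u) \<notin> E"
    and verts: "fst ` E \<union> snd ` E \<subseteq> pverts G"
    and inj: "inj_on pos (pverts G)"
    and no_isolated: "\<And>w. w \<in> pverts G \<Longrightarrow> neighborhood G w \<noteq> {}"
    and disj: "\<And>u v x y. (u, v) \<in> E \<Longrightarrow> (x, y) \<in> E \<Longrightarrow> (u, v) \<noteq> (x, y) \<Longrightarrow>
      closed_segment (pos u) (pos v) \<inter> closed_segment (pos x) (pos y) \<subseteq> pos ` ({u, v} \<inter> {x, y})"
  shows "planar G"
proof -
  let ?crv = "\<lambda>(u, v). linepath (pos u) (pos v)"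
  have disj': "closed_segment (pos u) (pos v) \<inter> closed_segment (pos x) (pos y)
      \<subseteq> pos ` ({u, v} \<inter> {x, y})"
    if "(u, v) \<in> parcs G" "(x, y) \<in> parcs G" "{u, v} \<noteq> {x, y}" for u v x y
    using that disj[of u v x y] disj[of u v y x] disj[of v u x y] disj[of v u y x]
    unfolding arcs
    by (auto simp: closed_segment_commute[of "pos v" "pos u"]
        closed_segment_commute[of "pos y" "pos x"] insert_commute)
  have wf: "u \<in> pverts G" "v \<in> pverts G" "u \<noteq> v" if "(u, v) \<in> parcs G" for u v
    using that verts loopfree unfolding arcs by (auto simp: image_subset_iff)
  have verts_off: "w \<in> {u, v}"
    if uv: "(u, v) \<in> parcs G" and w: "w \<in> pverts G" "pos w \<in> closed_segment (pos u) (pos v)" for u v w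
  proof (rule ccontr)
    assume nw: "w \<notin> {u, v}"
    then obtain z where z: "(w, z) \<in> parcs G"
      using w(1) no_isolated[of w] by (auto simp: neighborhood_def)
    then have "pos w \<in> pos ` ({u, v} \<inter> {w, z})"
      using disj'[OF uv z] w(2) nw by auto
    then show False
      using inj w(1) nw wf[OF uv] wf[OF z] by (auto simp: inj_on_def)
  qed
  have ends_neq: "pos u \<noteq> pos v" if "(u, v) \<in> parcs G" for u v
    using wf[OF that] inj by (auto simp: inj_on_def)
  have "plane_drawing G pos ?crv"
    unfolding plane_drawing_def
  proof (intro conjI)
    show "\<forall>(u, v)\<in>parcs G. arc (?crv (u, v)) \<and> pathstart (?crv (u, v)) = pos u \<and>
        pathfinish (?crv (u, v)) = pos v \<and> ?crv (v, u) = reversepath (?crv (u, v))"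
      using ends_neq by (auto simp: arc_linepath)
    show "\<forall>(u, v)\<in>parcs G. \<forall>w\<in>pverts G. pos w \<in> path_image (?crv (u, v)) \<longrightarrow> w \<in> {u, v}"
      using verts_off by auto
    show "\<forall>(u, v)\<in>parcs G. \<forall>(x, y)\<in>parcs G. {u, v} \<noteq> {x, y} \<longrightarrow>
        path_image (?crv (u, v)) \<inter> path_image (?crv (x, y)) \<subseteq> pos ` ({u, v} \<inter> {x, y})"
      using disj' by (simp add: split_beta)
  qed (rule inj)
  then show ?thesis
    unfolding planar_def by blast
qed

section \<open>A cycle tethered to a star\<close>

text \<open>
  The vertices are the cycle \<open>0, \<dots>, c\<close>, the tether \<open>c + 1\<close>, the hub \<open>c + 2\<close> of degree \<open>d\<close> and
  its \<open>d - 1\<close> leaves. Attaching the tether at \<open>c\<close> makes all edges but \<open>{0, c}\<close> and the leaf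
  edges steps \<open>{j, j + 1}\<close>.
\<close>

definition tethered_edges :: "nat \<Rightarrow> nat \<Rightarrow> (nat \<times> nat) set" where
  "tethered_edges c d =
     {(j, Suc j) | j. j \<le> c + 1} \<union> {(0, c)} \<union> {(c + 2, k) | k. c + 3 \<le> k \<and> k \<le> c + 1 + d}"

definition tethered_cycle :: "nat \<Rightarrow> nat \<Rightarrow> nat pair_pre_digraph" where
  "tethered_cycle c d =
     \<lparr> pverts = {..c + 1 + d}, parcs = tethered_edges c d \<union> (tethered_edges c d)\<inverse> \<rparr>"

lemma tethered_cycle_simps [simp]:
  "pverts (tethered_cycle c d) = {..c + 1 + d}"
  "parcs (tethered_cycle c d) = tethered_edges c d \<union> (tethered_edges c d)\<inverse>"
  by (simp_all add: tethered_cycle_def)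

text \<open>
  The path \<open>1, \<dots>, c + 2\<close> runs along the real axis and the leaves stand on a vertical line to the
  right of the hub. Lifting the vertex 0 off the axis makes room for the closing edge \<open>{0, c}\<close> of
  the cycle.
\<close>

definition tethered_pos :: "nat \<Rightarrow> nat \<Rightarrow> complex" where
  "tethered_pos c j = (if j = 0 then Complex 0 1 else if j \<le> c + 2 then Complex (real j) 0
     else Complex (real c + 3) (real j - real c - 3))"

definition tethered_coloring :: "nat \<Rightarrow> nat \<Rightarrow> nat" where
  "tethered_coloring c v = (if v \<le> c then if even v then 1 else 3
     else if v = c + 1 then 2 else if v = c + 2 then 4 else 1)"

lemma tethered_edges_iff:
  "(u, v) \<in> tethered_edges c d \<longleftrightarrow>
     v = Suc u \<and> u \<le> c + 1 \<or> u = 0 \<and> v = c \<or> u = c + 2 \<and> c + 3 \<le> v \<and> v \<le> c + 1 + d"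
  by (auto simp: tethered_edges_def)

context
  fixes c d :: nat
  assumes c: "3 \<le> c" and d: "1 \<le> d"
begin

lemma pair_graph_tethered_cycle: "pair_graph (tethered_cycle c d)"
proof -
  have sub: "tethered_edges c d \<subseteq> {..c + 1 + d} \<times> {..c + 1 + d}"
    using d by (auto simp: tethered_edges_def)
  then have fin: "finite (tethered_edges c d)"
    by (rule finite_subset) simp
  have "sym (parcs (tethered_cycle c d))"
    by (simp add: sym_Un_converse)
  moreover have "(u, u) \<notin> tethered_edges c d" for u
    using c by (auto simp: tethered_edges_iff)
  ultimately show ?thesis
    using sub fin by unfold_locales (auto simp: symmetric_def)
qed

lemma neighborhood_tethered_cycle:
  "neighborhood (tethered_cycle c d) 0 = {1, c}"
  "0 < j \<Longrightarrow> j < c \<Longrightarrow> neighborhood (tethered_cycle c d) j = {j - 1, j + 1}"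
  "neighborhood (tethered_cycle c d) c = {0, c - 1, c + 1}"
  "neighborhood (tethered_cycle c d) (c + 1) = {c, c + 2}"
  "neighborhood (tethered_cycle c d) (c + 2) = insert (c + 1) {c + 3..c + 1 + d}"
  "c + 3 \<le> j \<Longrightarrow> j \<le> c + 1 + d \<Longrightarrow> neighborhood (tethered_cycle c d) j = {c + 2}"
  using c d
  by - (rule set_eqI, simp add: neighborhood_def tethered_edges_iff, presburger?)+

text \<open>
  The simplifier turns \<open>c + 1\<close> and \<open>c + 2\<close> into successors before it can apply the equations
  above, so they are needed in that form as well.
\<close>

lemmas neighborhood_simps = neighborhood_tethered_cycle[simplified]

lemma tethered_cycle_vertex_cases [consumes 1]:
  assumes "v \<in> pverts (tethered_cycle c d)"
  obtains (origin) "v = 0" | (cycle) "0 < v" "v < c" | (anchor) "v = c" | (tether) "v = c + 1"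
    | (hub) "v = c + 2" | (leaf) "c + 3 \<le> v" "v \<le> c + 1 + d"
proof -
  have "v = 0 \<or> 0 < v \<and> v < c \<or> v = c \<or> v = c + 1 \<or> v = c + 2 \<or> c + 3 \<le> v"
    by linarith
  then show thesis using that assms by (elim disjE) simp_all
qed

lemma max_degree_tethered_cycle:
  assumes "3 \<le> d"
  shows "max_degree (tethered_cycle c d) = d"
  unfolding max_degree_def
proof (rule Max_eqI)
  show "finite ((\<lambda>v. card (neighborhood (tethered_cycle c d) v)) ` pverts (tethered_cycle c d))"
    by simp
  have hub: "card (neighborhood (tethered_cycle c d) (c + 2)) = d"
    using d by (simp add: neighborhood_simps)
  then show "d \<in> (\<lambda>v. card (neighborhood (tethered_cycle c d) v)) ` pverts (tethered_cycle c d)"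
    using d by (intro image_eqI[of _ _ "c + 2"]) auto
  fix y assume "y \<in> (\<lambda>v. card (neighborhood (tethered_cycle c d) v)) ` pverts (tethered_cycle c d)"
  then obtain v where v: "v \<in> pverts (tethered_cycle c d)"
    and y: "y = card (neighborhood (tethered_cycle c d) v)" by auto
  from v show "y \<le> d"
    unfolding y
    by (cases rule: tethered_cycle_vertex_cases)
      (use hub assms c in \<open>auto simp: neighborhood_simps card_insert_if\<close>)
qed

lemma bipartite_tethered_cycle:
  assumes "odd c"
  shows "bipartite (tethered_cycle c d)"
proof -
  let ?A = "{v \<in> {..c + 1 + d}. odd v \<and> v \<le> c + 2}"
  let ?B = "{v \<in> {..c + 1 + d}. even v \<or> c + 3 \<le> v}"
  have "tethered_edges c d \<subseteq> ?A \<times> ?B \<union> ?B \<times> ?A"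
  proof (rule subrelI)
    fix u v assume "(u, v) \<in> tethered_edges c d"
    then show "(u, v) \<in> ?A \<times> ?B \<union> ?B \<times> ?A"
      using assms d by (auto simp: tethered_edges_iff)
  qed
  then have "parcs (tethered_cycle c d) \<subseteq> ?A \<times> ?B \<union> ?B \<times> ?A" by auto
  moreover have "pverts (tethered_cycle c d) = ?A \<union> ?B" by auto
  moreover have "?A \<inter> ?B = {}" by auto
  ultimately show ?thesis
    unfolding bipartite_def by blast
qed

text \<open>
  A nonempty vertex set of minimum degree at least 2 contains no leaf, hence not the hub, hence not the
  tether, so it lies on the cycle. There every vertex has just two neighbors, so the set is
  closed under going round and is the whole cycle.
\<close>

lemma girth_tethered_cycle: "enat (c + 1) \<le> girth (tethered_cycle c d)"
  unfolding girth_def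
proof (rule INF_greatest, clarify)
  fix p assume p: "pre_digraph.cycle (with_proj (tethered_cycle c d)) p" "3 \<le> length p"
  obtain C where C: "C \<noteq> {}" "C \<subseteq> pverts (tethered_cycle c d)" "card C = length p"
    and two: "\<And>v. v \<in> C \<Longrightarrow> \<exists>a\<in>C. \<exists>b\<in>C. a \<noteq> b \<and>
      a \<in> neighborhood (tethered_cycle c d) v \<and> b \<in> neighborhood (tethered_cycle c d) v"
    by (rule cycle_vertices_two_neighbors[OF pair_graph_tethered_cycle p]) (rule that)
  have leaf: "v \<notin> C" if "c + 3 \<le> v" for v
    using that two[of v] C(2) neighborhood_tethered_cycle(6)[of v] by auto
  have hub: "c + 2 \<notin> C"
    using two[of "c + 2"] leaf by (auto simp: neighborhood_simps)
  have tether: "c + 1 \<notin> C"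
    using two[of "c + 1"] hub by (auto simp: neighborhood_simps)
  have "v \<le> c" if "v \<in> C" for v
  proof (rule ccontr)
    assume "\<not> v \<le> c"
    then have "v = c + 1 \<or> v = c + 2 \<or> c + 3 \<le> v" by linarith
    then show False using that leaf hub tether by auto
  qed
  then have le: "\<And>v. v \<in> C \<Longrightarrow> v \<le> c" .
  have down: "v - 1 \<in> C" if "v \<in> C" "0 < v" for v
  proof (cases "v < c")
    case True
    then show ?thesis using two[OF that(1)] neighborhood_tethered_cycle(2)[OF that(2)] by auto
  next
    case False
    then have "v = c" using le[OF that(1)] by simp
    then show ?thesis
      using two[OF that(1)] tether neighborhood_tethered_cycle(3) by auto
  qed
  have to0: "0 \<in> C" if "v \<in> C" for v
    using that
  proof (induction v)
    case (Suc v)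
    then show ?case using down[of "Suc v"] by simp
  qed
  then have "0 \<in> C" using C(1) by blast
  then have "1 \<in> C" "c \<in> C"
    using two[of 0] by (auto simp: neighborhood_simps)
  have "c - j \<in> C" for j
  proof (induction j)
    case 0
    then show ?case using \<open>c \<in> C\<close> by simp
  next
    case (Suc j)
    then show ?case using \<open>0 \<in> C\<close> down[of "c - j"] by (cases "c - j = 0") auto
  qed
  then have "j \<in> C" if "j \<le> c" for j
    using that by (metis diff_diff_cancel)
  then have "{..c} \<subseteq> C" by auto
  moreover have "finite C" using C(2) finite_subset by fastforce
  ultimately have "card {..c} \<le> card C" by (rule card_mono[rotated])
  then show "enat (c + 1) \<le> enat (length p)" using C(3) by simp
qed

lemma closed_segment_Re_Im:
  assumes "z \<in> closed_segment a b"
  obtains t where "0 \<le> t" "t \<le> 1" "Re z = Re a + t * (Re b - Re a)" "Im z = Im a + t * (Im b - Im a)"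
proof -
  obtain t where t: "0 \<le> t" "t \<le> 1" "z = (1 - t) *\<^sub>R a + t *\<^sub>R b"
    using assms by (auto simp: in_segment)
  show thesis
    by (rule that[of t]) (simp_all add: t algebra_simps)
qed

lemma segment_from_apex:
  assumes "z \<in> closed_segment (tethered_pos c 0) (tethered_pos c b)" "0 < b" "b \<le> c"
  shows "0 \<le> Im z \<and> Im z \<le> 1 \<and> Re z = real b * (1 - Im z)"
proof (rule closed_segment_Re_Im[OF assms(1)])
  fix t assume "0 \<le> t" "t \<le> 1"
    and "Re z = Re (tethered_pos c 0) + t * (Re (tethered_pos c b) - Re (tethered_pos c 0))"
    and "Im z = Im (tethered_pos c 0) + t * (Im (tethered_pos c b) - Im (tethered_pos c 0))"
  then have "0 \<le> t \<and> t \<le> 1 \<and> Im z = 1 - t \<and> Re z = t * real b"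
    using assms(2-) by (simp add: tethered_pos_def)
  then show ?thesis by auto
qed

lemma segment_on_axis:
  assumes "z \<in> closed_segment (tethered_pos c u) (tethered_pos c (Suc u))" "0 < u" "u \<le> c + 1"
  shows "Im z = 0 \<and> real u \<le> Re z \<and> Re z \<le> real u + 1"
  by (rule closed_segment_Re_Im[OF assms(1)])
    (use assms(2-) in \<open>simp add: tethered_pos_def algebra_simps\<close>)

lemma segment_from_hub:
  assumes "z \<in> closed_segment (tethered_pos c (c + 2)) (tethered_pos c k)" "c + 3 \<le> k"
  shows "real c + 2 \<le> Re z \<and> Im z = (real k - real c - 3) * (Re z - (real c + 2))"
  by (rule closed_segment_Re_Im[OF assms(1)])
    (use assms(2-) in \<open>simp add: tethered_pos_def algebra_simps\<close>)

text \<open>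
  Edges fall into three classes: the two at the apex 0 lie over the strip left of \<open>c\<close>, the path
  edges on the real axis left of the hub, and the leaf edges right of the hub. Two edges of the
  fan at 0, or of the fan at the hub, are on different lines through a common vertex; edges of
  different classes can only meet on the real axis.
\<close>

lemma segments_meet_in_common_ends:
  assumes uv: "(u, v) \<in> tethered_edges c d" and xy: "(x, y) \<in> tethered_edges c d"
    and ne: "(u, v) \<noteq> (x, y)"
  shows "closed_segment (tethered_pos c u) (tethered_pos c v) \<inter>
    closed_segment (tethered_pos c x) (tethered_pos c y) \<subseteq> tethered_pos c ` ({u, v} \<inter> {x, y})"
  using assms
proof (induction u x arbitrary: v y rule: linorder_wlog)
  case (sym u x)
  then show ?case by (metis Int_commute)
next
  case (le u x)
  have kinds: "u = 0 \<and> 0 < v \<and> v \<le> c \<and> (v = 1 \<or> v = c) \<or> 0 < u \<and> u \<le> c + 1 \<and> v = Suc u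
      \<or> u = c + 2 \<and> c + 3 \<le> v" if "(u, v) \<in> tethered_edges c d" for u v
    using that c by (auto simp: tethered_edges_iff)
  show ?case
  proof (rule subsetI, elim IntE)
    fix z
    assume z: "z \<in> closed_segment (tethered_pos c u) (tethered_pos c v)"
      and z': "z \<in> closed_segment (tethered_pos c x) (tethered_pos c y)"
    consider (apex) "u = 0" "0 < v" "v \<le> c" | (axis) "0 < u" "u \<le> c + 1" "v = Suc u"
      | (hub) "u = c + 2" "c + 3 \<le> v"
      using kinds[OF le(2)] by blast
    then have "\<exists>w \<in> {u, v} \<inter> {x, y}. z = tethered_pos c w"
    proof cases
      case apex
      note on_uv = segment_from_apex[of z v, OF _ apex(2,3)]
      consider "x = 0" "0 < y" "y \<le> c" | "0 < x" "x \<le> c + 1" "y = Suc x"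
        | "x = c + 2" "c + 3 \<le> y"
        using kinds[OF le(3)] by blast
      then show ?thesis
      proof cases
        case 1
        then have "v \<noteq> y" using apex le(4) by auto
        moreover have "real v * (1 - Im z) = real y * (1 - Im z)"
          using on_uv segment_from_apex[of z y, OF _ 1(2,3)] z z' apex(1) 1(1) by metis
        ultimately have "Im z = 1" by auto
        then have "z = tethered_pos c 0"
          using on_uv z apex(1) by (simp add: tethered_pos_def complex_eq_iff)
        then show ?thesis using apex(1) 1(1) by auto
      next
        case 2
        have "Im z = 0" "Re z = real v" "real x \<le> real v" "real v \<le> real x + 1"
          using on_uv segment_on_axis[of z x, OF _ 2(1,2)] z z' apex(1) 2(3) by auto
        then have "v = x \<or> v = y" "z = tethered_pos c v"
          using 2 apex by (auto simp: tethered_pos_def complex_eq_iff)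
        then show ?thesis by auto
      next
        case 3
        have "0 \<le> Im z" "Re z = real v * (1 - Im z)" "real c + 2 \<le> Re z"
          using on_uv segment_from_hub[of z y, OF _ 3(2)] z z' apex(1) 3(1) by auto
        moreover have "real v * (1 - Im z) \<le> real v"
          using \<open>0 \<le> Im z\<close> by (simp add: mult_left_le)
        ultimately show ?thesis using apex(3) by linarith
      qed
    next
      case axis
      have on_uv: "Im z = 0" "real u \<le> Re z" "Re z \<le> real u + 1"
        using segment_on_axis[of z u, OF _ axis(1,2)] z axis(3) by auto
      consider "x \<le> c + 1" "y = Suc x" | "x = c + 2" "c + 3 \<le> y"
        using kinds[OF le(3)] le(1) axis(1) by auto
      then show ?thesis
      proof cases
        case 1
        have "real x \<le> Re z"
          using segment_on_axis[of z x] z' 1 axis(1) le(1) by auto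
        moreover have "u < x" using le(1,4) axis(3) 1(2) by (auto simp: le_less)
        ultimately have "x = Suc u" "Re z = real x" using on_uv by linarith+
        then have "z = tethered_pos c x"
          using on_uv 1 by (simp add: tethered_pos_def complex_eq_iff)
        then show ?thesis using \<open>x = Suc u\<close> axis(3) by auto
      next
        case 2
        have "real c + 2 \<le> Re z"
          using segment_from_hub[of z y, OF _ 2(2)] z' 2(1) by auto
        then have "u = c + 1" "Re z = real c + 2" using on_uv axis(2) by linarith+
        then have "z = tethered_pos c x"
          using on_uv 2(1) by (simp add: tethered_pos_def complex_eq_iff)
        then show ?thesis using \<open>u = c + 1\<close> axis(3) 2(1) by auto
      qed
    next
      case hub
      then have x: "x = c + 2" "c + 3 \<le> y"
        using kinds[OF le(3)] le(1) by auto
      have "Im z = (real v - real c - 3) * (Re z - (real c + 2))"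
          "Im z = (real y - real c - 3) * (Re z - (real c + 2))"
        using segment_from_hub[of z v, OF _ hub(2)] segment_from_hub[of z y, OF _ x(2)]
          z z' hub(1) x(1) by auto
      moreover have "v \<noteq> y" using hub x le(4) by auto
      ultimately have "Re z = real c + 2" "Im z = 0" by auto
      then have "z = tethered_pos c x"
        using x(1) by (simp add: tethered_pos_def complex_eq_iff)
      then show ?thesis using x(1) hub(1) by auto
    qed
    then show "z \<in> tethered_pos c ` ({u, v} \<inter> {x, y})" by blast
  qed
qed

lemma planar_tethered_cycle: "planar (tethered_cycle c d)"
proof (rule straight_line_planar)
  show "parcs (tethered_cycle c d) = tethered_edges c d \<union> (tethered_edges c d)\<inverse>" by simp
  show "(u, u) \<notin> tethered_edges c d" for u
    using c by (auto simp: tethered_edges_iff)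
  show "fst ` tethered_edges c d \<union> snd ` tethered_edges c d \<subseteq> pverts (tethered_cycle c d)"
    using d by (auto simp: tethered_edges_def)
  show "inj_on (tethered_pos c) (pverts (tethered_cycle c d))"
    by (auto simp: inj_on_def tethered_pos_def split: if_splits)
  show "neighborhood (tethered_cycle c d) w \<noteq> {}" if "w \<in> pverts (tethered_cycle c d)" for w
    using that by (cases rule: tethered_cycle_vertex_cases) (auto simp: neighborhood_simps)
qed (rule segments_meet_in_common_ends)

section \<open>Odd-sum colorings of the tethered cycle\<close>

text \<open>
  The linear algebra of the proof. With \<open>c\<close> divisible by 3, the period 3 along the path
  \<open>0, \<dots>, c\<close> identifies the parities at \<open>0\<close> and \<open>c\<close> and those at \<open>2\<close> and \<open>c - 1\<close>; the equation
  at 0 then yields the parity at 1, and the one at \<open>c\<close>, together with the even tether, the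
  parity at 2.
\<close>

lemma odd_sum_coloring_parities:
  assumes f: "odd_sum_coloring (tethered_cycle c d) f" and mod: "c mod 3 = 0" and "even d"
  shows "odd (f 0)" "odd (f 1)" "even (f (c + 1))" "even (f (c + 2))"
proof -
  let ?G = "tethered_cycle c d"
  have odd_sum: "odd (f v + (\<Sum>w \<in> neighborhood ?G v. f w))"
    if "v \<in> pverts ?G" for v
  proof -
    interpret pair_graph ?G by (rule pair_graph_tethered_cycle)
    have "neighborhood ?G v \<subseteq> pverts ?G"
      using in_arcsD2 by (auto simp: neighborhood_def)
    then have "finite (neighborhood ?G v)" using finite_subset by fastforce
    moreover have "v \<notin> neighborhood ?G v" using no_loops' by (auto simp: neighborhood_def)
    ultimately have "(\<Sum>w \<in> closed_neighborhood ?G v. f w) = f v + (\<Sum>w \<in> neighborhood ?G v. f w)"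
      by (simp add: closed_neighborhood_def)
    moreover have "odd (\<Sum>w \<in> closed_neighborhood ?G v. f w)"
      using f that by (simp add: odd_sum_coloring_def del: tethered_cycle_simps)
    ultimately show ?thesis by simp
  qed
  show tether: "even (f (c + 1))"
  proof -
    define L where "L = {c + 3..c + 1 + d}"
    have L: "finite L" "c + 1 \<notin> L" "card L = d - 1"
      by (auto simp: L_def)
    then have odd_L: "odd (card L)"
      using \<open>even d\<close> d by simp
    \<comment> \<open>The leaves are all odd or all even, so the odd number \<open>d - 1\<close> of them acts like one leaf.\<close>
    have leaf: "odd (f j) \<longleftrightarrow> even (f (c + 2))" if "j \<in> L" for j
      using odd_sum[of j] neighborhood_tethered_cycle(6)[of j] that by (simp add: L_def)
    have "even (\<Sum>j \<in> L. f j) \<longleftrightarrow> odd (f (c + 2))"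
    proof (cases "even (f (c + 2))")
      case True
      then have "{j \<in> L. odd (f j)} = L" using leaf by blast
      then show ?thesis using True odd_L even_sum_iff[OF L(1), of f] by metis
    next
      case False
      then have "\<And>j. j \<in> L \<Longrightarrow> even (f j)" using leaf by blast
      then show ?thesis using False by (simp add: dvd_sum)
    qed
    moreover have "odd (f (c + 2) + (f (c + 1) + (\<Sum>j \<in> L. f j)))"
      using odd_sum[of "c + 2"] L(1,2) d
      unfolding neighborhood_tethered_cycle(5) L_def[symmetric] by simp
    ultimately show ?thesis by auto
  qed
  have path: "odd (f j + f (Suc j) + f (Suc (Suc j)))" if "Suc (Suc j) \<le> c" for j
    using odd_sum[of "Suc j"] neighborhood_tethered_cycle(2)[of "Suc j"] that by auto
  have shift: "even (f (Suc (Suc (Suc j)))) \<longleftrightarrow> even (f j)" if "Suc (Suc (Suc j)) \<le> c" for j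
    using path[of j] path[of "Suc j"] that by auto
  have period: "even (f (3 * i + r)) \<longleftrightarrow> even (f r)" if "3 * i + r \<le> c" for i r
    using that
  proof (induction i)
    case (Suc i)
    have eq: "3 * Suc i + r = Suc (Suc (Suc (3 * i + r)))" by simp
    have "even (f (3 * Suc i + r)) \<longleftrightarrow> even (f (3 * i + r))"
      using Suc.prems unfolding eq by (rule shift)
    then show ?case using Suc by simp
  qed simp
  obtain m where m: "c = 3 * m" using mod by auto
  have c0: "even (f c) \<longleftrightarrow> even (f 0)" using period[of m 0] m by simp
  have c2: "even (f (c - 1)) \<longleftrightarrow> even (f 2)"
  proof -
    have "c - 1 = 3 * (m - 1) + 2" using m c by simp
    then show ?thesis using period[of "m - 1" 2] by simp
  qed
  have "odd (f 0 + (f 1 + f c))"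
    using odd_sum[of 0] c neighborhood_tethered_cycle(1) by auto
  then show f1: "odd (f 1)"
    using c0 by auto
  have "odd (f c + (f 0 + (f (c - 1) + f (c + 1))))"
    using odd_sum[of c] c neighborhood_tethered_cycle(3) by auto
  then have "odd (f 2)"
    using c0 c2 tether by auto
  then show f0: "odd (f 0)"
    using path[of 0] f1 c by (simp flip: numeral_2_eq_2)
  have "odd (f (c + 1) + (f c + f (c + 2)))"
    using odd_sum[of "c + 1"] d unfolding neighborhood_tethered_cycle(4) by simp
  then show "even (f (c + 2))"
    using tether c0 f0 by auto
qed

lemma odd_sum_coloring_card_ge:
  assumes f: "odd_sum_coloring (tethered_cycle c d) f" and "c mod 3 = 0" and "even d"
  shows "4 \<le> card (f ` pverts (tethered_cycle c d))"
proof -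
  note parity = odd_sum_coloring_parities[OF assms]
  have "(0, 1) \<in> parcs (tethered_cycle c d)" "(c + 1, c + 2) \<in> parcs (tethered_cycle c d)"
    by (auto simp: tethered_edges_iff)
  then have "f 0 \<noteq> f 1" "f (c + 1) \<noteq> f (c + 2)"
    using f unfolding odd_sum_coloring_def coloring_def by blast+
  moreover have "f a \<noteq> f b" if "odd (f a)" "even (f b)" for a b using that by auto
  ultimately have "card (f ` {0, 1, c + 1, c + 2}) = 4"
    using parity by (simp add: card_insert_if)
  moreover have "f ` {0, 1, c + 1, c + 2} \<subseteq> f ` pverts (tethered_cycle c d)"
    using d by (intro image_mono) auto
  ultimately show ?thesis
    by (metis card_mono finite_imageI finite_atMost tethered_cycle_simps(1))
qed

text \<open>
  Proper on the cycle because its length \<open>c + 1\<close> is even; the sum at the hub is \<open>4 + 2\<close> plus an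
  odd number of ones.
\<close>

lemma tethered_coloring_odd_sum:
  assumes "odd c" "even d"
  shows "odd_sum_coloring (tethered_cycle c d) (tethered_coloring c)"
proof -
  have "coloring (tethered_cycle c d) (tethered_coloring c)"
    using assms(1) by (auto simp: coloring_def tethered_edges_iff tethered_coloring_def)
  moreover have "odd (\<Sum>w \<in> closed_neighborhood (tethered_cycle c d) v. tethered_coloring c w)"
    if "v \<in> pverts (tethered_cycle c d)" for v
    using that
  proof (cases rule: tethered_cycle_vertex_cases)
    case hub
    define L where "L = {c + 3..c + 1 + d}"
    have L: "finite L" "c + 1 \<notin> L" "c + 2 \<notin> L" "card L = d - 1"
      by (auto simp: L_def)
    have "(\<Sum>w \<in> L. tethered_coloring c w) = (\<Sum>w \<in> L. 1)"
      by (rule sum.cong) (auto simp: L_def tethered_coloring_def)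
    moreover have "closed_neighborhood (tethered_cycle c d) v = insert (c + 2) (insert (c + 1) L)"
      unfolding hub closed_neighborhood_def neighborhood_tethered_cycle(5) L_def by blast
    ultimately have "(\<Sum>w \<in> closed_neighborhood (tethered_cycle c d) v. tethered_coloring c w)
        = 6 + (d - 1)"
      using L by (simp add: tethered_coloring_def)
    then show ?thesis using assms(2) d by simp
  next
    case origin
    then show ?thesis
      using c assms(1)
      by (simp add: closed_neighborhood_def neighborhood_simps tethered_coloring_def)
  next
    case cycle
    then obtain u where "v = Suc u" by (cases v) auto
    moreover have "closed_neighborhood (tethered_cycle c d) v = {v - 1, v, v + 1}"
      using neighborhood_tethered_cycle(2)[OF cycle] by (auto simp: closed_neighborhood_def)
    ultimately show ?thesis
      using cycle by (simp add: tethered_coloring_def)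
  next
    case anchor
    moreover obtain b where "c = Suc b" "even b" "b \<noteq> 0" using c assms(1) by (cases c) auto
    moreover have "closed_neighborhood (tethered_cycle c d) v = {0, c - 1, c, c + 1}"
      using anchor neighborhood_tethered_cycle(3) by (auto simp: closed_neighborhood_def)
    ultimately show ?thesis
      by (simp add: tethered_coloring_def)
  next
    case tether
    then show ?thesis
      using assms(1)
      by (simp add: closed_neighborhood_def neighborhood_simps tethered_coloring_def)
  next
    case leaf
    then show ?thesis
      by (simp add: closed_neighborhood_def neighborhood_simps tethered_coloring_def)
  qed
  ultimately show ?thesis by (simp add: odd_sum_coloring_def)
qed

lemma odd_sum_chromatic_number_tethered_cycle:
  assumes "odd c" "c mod 3 = 0" "even d"
  shows "odd_sum_chromatic_number (tethered_cycle c d) = 4"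
proof -
  let ?G = "tethered_cycle c d"
  have "tethered_coloring c ` pverts ?G \<subseteq> {1, 2, 3, 4}"
    by (auto simp: tethered_coloring_def)
  then have "card (tethered_coloring c ` pverts ?G) \<le> card {1, 2, 3, 4 :: nat}"
    by (intro card_mono) auto
  moreover note col = tethered_coloring_odd_sum[OF assms(1,3)]
  ultimately have "card (tethered_coloring c ` pverts ?G) = 4"
    using odd_sum_coloring_card_ge[OF col assms(2,3)] by simp
  then show ?thesis
    unfolding odd_sum_chromatic_number_def
    using col odd_sum_coloring_card_ge[OF _ assms(2,3)]
    by (intro cInf_eq_minimum) auto
qed

end

theorem theorem2:
  fixes \<Delta> g :: nat
  assumes "even \<Delta>" and "4 \<le> \<Delta>" and "0 < g"
  shows "\<exists>G :: nat pair_pre_digraph.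
           pair_graph G \<and> bipartite G \<and> planar G \<and> max_degree G = \<Delta> \<and> enat g \<le> girth G \<and>
           odd_sum_chromatic_number G = 4"
proof -
  \<comment> \<open>Odd for bipartiteness, divisible by 3 for the parities, and at least \<open>g\<close> for the girth.\<close>
  define c where "c = 6 * g + 3"
  have c: "3 \<le> c" "odd c" "c mod 3 = 0" and d: "1 \<le> \<Delta>" "3 \<le> \<Delta>"
    using assms(2) by (auto simp: c_def)
  have "enat g \<le> enat (c + 1)" by (simp add: c_def)
  also have "\<dots> \<le> girth (tethered_cycle c \<Delta>)"
    by (rule girth_tethered_cycle[OF c(1) d(1)])
  finally show ?thesis
    using c d assms(1)
    by (intro exI[of _ "tethered_cycle c \<Delta>"] conjI pair_graph_tethered_cycle
        bipartite_tethered_cycle planar_tethered_cycle max_degree_tethered_cycle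
        odd_sum_chromatic_number_tethered_cycle)
qed

end
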